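(* Let $(X,\mathcal B)$ and $(Y,\mathcal D)$ be measurable spaces and let $F:X\times Y\to X$ be measurable. Let $\lambda$ be a probability measure on $(X,\mathcal B)$, and let $\psi_0,\psi_1,\ldots$ be a sequence of independent identically distributed $Y$-valued random variables with probability distribution $\nu$. Let $\Omega_Y=\prod_{n=0}^\infty Y$, with its cylinder sigma-algebra $\mathcal C$. Then there exist a probability measure $\mathbb P$ on $(\Omega_Y,\mathcal C)$ and a sequence of $X$-valued random variables $T_0,T_1,\ldots$ on $\Omega_Y$ such that: (1) $\lambda$ is the distribution of $T_0$, that is, $$\int_{\Omega_Y}F(T_0(\omega),\cdot)\,d\mathbb P(\omega)=\int_XF(x,\cdot)\,d\lambda(x);$$ (2) $T_{n+1}=F(T_n,\psi_n)$, $n=0,1,\ldots$; (3) it holds that $$\mathbb E\left(f\circ T_{n+1}\,\big|\,\mathcal F_n\right)=\mathbb E\left(f\circ T_{n+1}\,\big|\,\mathcal G_n\right)=(R_F(f))\circ T_n,$$ where $\mathcal F_n=T_n^{-1}(\mathcal B)$ and $\mathcal G_n$ is the smallest sigma-algebra for which the variables $T_0,\ldots,T_n$ are measurable; (4) we have $$\int_{\Omega_Y}(f_0\circ T_0)(f_1\circ T_1)\cdots(f_n\circ T_n)\,d\mathbb P=\int_Xf_0(x)\,R_F\big(f_1R_F(f_2\cdots R_F(f_nh)\cdots)\big)(x)\,d\lambda(x)$$ with $f_0,f_1,\ldots,f_n\in\mathcal M(X,\mathcal B)$.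
   Context: $\mathcal M(X,\mathcal B)$ denotes the space of real-valued measurable functions on $X$. The transfer operator $R_F$ is defined by $(R_Ff)(x)=\int_Yf(F(x,y))\,d\nu(y)$ for $f\in\mathcal M(X,\mathcal B)$. The driving sequence is realized on $\Omega_Y$ by the coordinate functions $\psi_n(y_0,y_1,\ldots)=y_n$. The function $h$ in (4) is a positive measurable function on $X$ that is harmonic for the transfer operator, $R_Fh=h$, with $\int_Xh\,d\lambda=1$; in the normalized case, where the transfer operator maps the constant function $1$ to itself, one uses $h\equiv1$.
   Formalization: The sample space is X × Ω_Y instead of Ω_Y (on Ω_Y the claim fails, e.g. Y a point and λ not a point mass); in (4) h ≡ 1, as R_F 1 = 1 and (1) forces it; (3) and (4) are stated when f∘T_{n+1}, respectively the product, is integrable. *)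

theory Defs
  imports "HOL-Probability.Probability"
begin

text \<open>A measurable space is represented by a measure of which only the carrier and the
  sigma-algebra are used; a real function in M(X, B) is an element of
  \<^term>\<open>borel_measurable X\<close>.\<close>

definition transfer_op :: "'b measure \<Rightarrow> ('a \<times> 'b \<Rightarrow> 'a) \<Rightarrow> ('a \<Rightarrow> real) \<Rightarrow> 'a \<Rightarrow> real" where
  "transfer_op \<nu> F f = (\<lambda>x. \<integral>y. f (F (x, y)) \<partial>\<nu>)"

text \<open>As \<open>\<nu>\<close> is a probability measure, the transfer operator is always normalized, so
  the harmonic weight \<open>h\<close> in the path formula is the constant 1. A nonconstant weight would change the
  joint law of the process: for \<open>F (x, y) = x\<close>, for instance, every \<open>h\<close> is harmonic and the weighted
  formula would give the initial variable the law with density \<open>h\<close> instead of the prescribed one.\<close>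

lemma transfer_op_one:
  assumes "prob_space \<nu>"
  shows "transfer_op \<nu> F (\<lambda>_. 1) = (\<lambda>_. 1)"
proof -
  interpret prob_space \<nu> by fact
  show ?thesis by (simp add: transfer_op_def prob_space)
qed

text \<open>\<open>nested_transfer R h f m k\<close> is
  \<open>f\<^sub>k R (f\<^sub>k\<^sub>+\<^sub>1 R (\<dots> R (f\<^sub>k\<^sub>+\<^sub>m h) \<dots>))\<close>, with \<open>m\<close> applications of \<open>R\<close>.\<close>

primrec nested_transfer ::
    "(('a \<Rightarrow> real) \<Rightarrow> 'a \<Rightarrow> real) \<Rightarrow> ('a \<Rightarrow> real) \<Rightarrow> (nat \<Rightarrow> 'a \<Rightarrow> real) \<Rightarrow> nat \<Rightarrow> nat \<Rightarrow> 'a \<Rightarrow> real" where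
  "nested_transfer R h f 0 k = (\<lambda>x. f k x * h x)"
| "nested_transfer R h f (Suc m) k = (\<lambda>x. f k x * R (nested_transfer R h f m (Suc k)) x)"

definition path_space :: "'b measure \<Rightarrow> (nat \<Rightarrow> 'b) measure" where
  "path_space Y = (\<Pi>\<^sub>M n\<in>(UNIV :: nat set). Y)"

text \<open>The sample space is \<open>X \<times> Y\<^sup>\<nat>\<close>: besides the driving sequence it must carry an initial
  variable with an arbitrary law on \<open>X\<close>, and the path space of \<open>Y\<close> alone can be too small
  for that (see \<open>no_initial_variable_on_path_space\<close>).\<close>

definition sample_space :: "'a measure \<Rightarrow> 'b measure \<Rightarrow> ('a \<times> (nat \<Rightarrow> 'b)) measure" where
  "sample_space X Y = X \<Otimes>\<^sub>M path_space Y"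

definition driving :: "nat \<Rightarrow> 'a \<times> (nat \<Rightarrow> 'b) \<Rightarrow> 'b" where
  "driving n = (\<lambda>\<omega>. snd \<omega> n)"

lemma no_initial_variable_on_path_space:
  fixes X :: "bool measure" and Y :: "unit measure"
  defines "X \<equiv> count_space UNIV" and "Y \<equiv> count_space UNIV"
  shows "\<exists>lam. prob_space lam \<and> sets lam = sets X \<and>
    \<not> (\<exists>P T. prob_space P \<and> sets P = sets (path_space Y) \<and> T \<in> P \<rightarrow>\<^sub>M X \<and> distr P X T = lam)"
proof (intro exI conjI notI)
  let ?lam = "measure_pmf (bernoulli_pmf (1/2))"
  show "prob_space ?lam" by (rule prob_space_measure_pmf)
  show "sets ?lam = sets X" by (simp add: X_def)
  assume "\<exists>P T. prob_space P \<and> sets P = sets (path_space Y) \<and> T \<in> P \<rightarrow>\<^sub>M X \<and> distr P X T = ?lam"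
  then obtain P and T :: "(nat \<Rightarrow> unit) \<Rightarrow> bool"
    where P: "prob_space P" and T: "T \<in> P \<rightarrow>\<^sub>M X" and d: "distr P X T = ?lam"
    by blast
  interpret prob_space P by (rule P)
  have const: "T \<omega> = T (\<lambda>_. ())" for \<omega>
    by (rule arg_cong[of _ _ T]) auto
  have "T -` {T (\<lambda>_. ())} \<inter> space P = space P"
    using const by auto
  then have "measure (distr P X T) {T (\<lambda>_. ())} = 1"
    using T by (subst measure_distr) (auto simp: X_def prob_space)
  then have "pmf (bernoulli_pmf (1/2)) (T (\<lambda>_. ())) = 1"
    by (simp add: d pmf.rep_eq)
  then show False
    by (cases "T (\<lambda>_. ())") auto
qed

text \<open>The sigma-algebra generated by the variables \<open>T 0, \<dots>, T n\<close>; the one generated by a single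
  variable is the library's \<^const>\<open>vimage_algebra\<close>.\<close>

definition past_algebra :: "'w set \<Rightarrow> 'a measure \<Rightarrow> (nat \<Rightarrow> 'w \<Rightarrow> 'a) \<Rightarrow> nat \<Rightarrow> 'w measure" where
  "past_algebra \<Omega> X T n = sigma \<Omega> (\<Union>i\<le>n. {T i -` A \<inter> \<Omega> | A. A \<in> sets X})"

end

theory Submission
  imports Defs
begin

text \<open>
  Take for \<open>P\<close> the product of \<open>lam\<close> with countably many copies of \<open>\<nu>\<close>, for \<open>T 0\<close> the first
  projection, and let the recursion with \<open>F\<close> define the rest (\<open>T n\<close> is \<open>orbit F n\<close> below).
  Independence of the driving variables and the laws of \<open>driving n\<close> and \<open>T 0\<close> are then built
  into \<open>P\<close>.

  Both the Markov property and the path formula come from a single symmetry: replacing the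
  \<open>n\<close>-th driving value of a sample point by an independent value with law \<open>\<nu>\<close> leaves \<open>P\<close> invariant
  (\<open>distr_resample\<close>). The states \<open>T 0, \<dots>, T n\<close> do not see this replacement, because they use only
  the driving values before \<open>n\<close>, while \<open>T (n + 1)\<close> becomes \<open>F (T n, y)\<close> with \<open>y\<close> fresh.
  Integrating out \<open>y\<close> by Fubini turns \<open>f (T (n + 1))\<close> into \<open>(R f) (T n)\<close> against every weight that
  ignores the \<open>n\<close>-th driving value (\<open>one_step\<close>).

  With indicators of past events as weights this identity characterises the conditional
  expectation, simultaneously for all sigma-algebras between the one of \<open>T n\<close> and the one of
  \<open>T 0, \<dots>, T n\<close> (\<open>cond_exp_next_state\<close>). With the weight \<open>\<Prod>i\<le>n. f i (T i)\<close> it removes the last factor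
  of a product of length \<open>n + 2\<close>, and induction gives the path formula (\<open>integral_path_product\<close>);
  Fubini passes the integrability of the product on from each step to the next.
\<close>

section \<open>Orbits and resampling of one driving value\<close>

primrec orbit :: "('a \<times> 'b \<Rightarrow> 'a) \<Rightarrow> nat \<Rightarrow> 'a \<times> (nat \<Rightarrow> 'b) \<Rightarrow> 'a" where
  "orbit F 0 \<omega> = fst \<omega>"
| "orbit F (Suc n) \<omega> = F (orbit F n \<omega>, driving n \<omega>)"

definition resample :: "nat \<Rightarrow> 'a \<times> (nat \<Rightarrow> 'b) \<Rightarrow> 'b \<Rightarrow> 'a \<times> (nat \<Rightarrow> 'b)" where
  "resample n \<omega> y = (fst \<omega>, (snd \<omega>)(n := y))"

lemma orbit_resample: "i \<le> n \<Longrightarrow> orbit F i (resample n \<omega> y) = orbit F i \<omega>"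
  by (induction i) (auto simp: resample_def driving_def)

lemma orbit_Suc_resample: "orbit F (Suc n) (resample n \<omega> y) = F (orbit F n \<omega>, y)"
  by (simp add: orbit_resample) (simp add: resample_def driving_def)

text \<open>The weight \<open>h\<close> absorbs the last factor: this is the algebraic counterpart of integrating
  out the last driving variable, and the reason for proving the path formula with a general weight.\<close>

lemma nested_transfer_Suc_weight:
  "nested_transfer R h f (Suc m) k = nested_transfer R (R (\<lambda>x. f (Suc (m + k)) x * h x)) f m k"
proof (induction m arbitrary: k)
  case (Suc m)
  show ?case
    by (subst nested_transfer.simps(2), subst Suc.IH) simp
qed simp

section \<open>The driven process on the product space\<close>

locale random_iteration =
  lam: prob_space lam + \<nu>: prob_space \<nu>
  for X lam :: "'a measure" and Y \<nu> :: "'b measure" and F :: "'a \<times> 'b \<Rightarrow> 'a" +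
  assumes F [measurable]: "F \<in> X \<Otimes>\<^sub>M Y \<rightarrow>\<^sub>M X"
    and sets_lam [measurable_cong]: "sets lam = sets X"
    and sets_\<nu> [measurable_cong]: "sets \<nu> = sets Y"
begin

abbreviation S :: "(nat \<Rightarrow> 'b) measure" where
  "S \<equiv> \<Pi>\<^sub>M n\<in>UNIV. \<nu>"

abbreviation P :: "('a \<times> (nat \<Rightarrow> 'b)) measure" where
  "P \<equiv> lam \<Otimes>\<^sub>M S"

abbreviation R :: "('a \<Rightarrow> real) \<Rightarrow> 'a \<Rightarrow> real" where
  "R \<equiv> transfer_op \<nu> F"

sublocale S: prob_space S
  by (intro prob_space_PiM) unfold_locales

sublocale lam_S: pair_prob_space lam S ..

sublocale P_\<nu>: pair_prob_space P \<nu> ..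

lemma space_\<nu>: "space \<nu> = space Y"
  using sets_eq_imp_space_eq[OF sets_\<nu>] .

lemma sets_P: "sets P = sets (sample_space X Y)"
  unfolding sample_space_def path_space_def
  by (intro sets_pair_measure_cong sets_lam sets_PiM_cong refl sets_\<nu>)

lemma measurable_driving [measurable]: "driving n \<in> P \<rightarrow>\<^sub>M Y"
  unfolding driving_def by measurable

lemma measurable_orbit [measurable]: "orbit F n \<in> P \<rightarrow>\<^sub>M X"
proof (induction n)
  case 0
  have "orbit F 0 = fst"
    by (rule ext) simp
  then show ?case
    by simp
next
  case (Suc n)
  note [measurable] = this
  have "orbit F (Suc n) = (\<lambda>\<omega>. F (orbit F n \<omega>, driving n \<omega>))"
    by (rule ext) simp
  then show ?case
    by simp
qed

lemma measurable_resample [measurable]: "(\<lambda>(\<omega>, y). resample n \<omega> y) \<in> P \<Otimes>\<^sub>M \<nu> \<rightarrow>\<^sub>M P"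
proof -
  have "(\<lambda>z. (snd (fst z))(n := snd z)) \<in> (P \<Otimes>\<^sub>M \<nu>) \<rightarrow>\<^sub>M S"
    by (rule measurable_PiM_single') (auto simp: space_pair_measure space_PiM PiE_iff fun_upd_def)
  then show ?thesis
    unfolding resample_def case_prod_beta by measurable
qed

lemma resample_in_space: "\<omega> \<in> space P \<Longrightarrow> y \<in> space Y \<Longrightarrow> resample n \<omega> y \<in> space P"
  by (auto simp: resample_def space_pair_measure space_PiM space_\<nu>)

lemma measurable_transfer_op [measurable]:
  assumes [measurable]: "f \<in> borel_measurable X"
  shows "R f \<in> borel_measurable X"
  unfolding transfer_op_def by measurable

lemma distr_driving_sequence: "distr P S snd = S"
proof (rule measure_eqI)
  fix A assume "A \<in> sets (distr P S snd)"
  then have A: "A \<in> sets S"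
    by simp
  then have "snd -` A \<inter> space P = space lam \<times> A"
    by (auto simp: space_pair_measure dest: sets.sets_into_space)
  then show "emeasure (distr P S snd) A = emeasure S A"
    using A by (simp add: emeasure_distr S.emeasure_pair_measure_Times lam.emeasure_space_1)
qed simp

lemma distr_driving: "distr P Y (driving n) = \<nu>"
proof -
  have "distr P Y (driving n) = distr (distr P S snd) \<nu> (\<lambda>s. s n)"
    by (subst distr_distr) (auto intro!: distr_cong simp: driving_def sets_\<nu>)
  also have "\<dots> = \<nu>"
    unfolding distr_driving_sequence by (intro distr_PiM_component) (auto intro: \<nu>.prob_space_axioms)
  finally show ?thesis .
qed

lemma indep_vars_driving: "lam_S.indep_vars (\<lambda>_. Y) driving UNIV"
proof (subst lam_S.indep_vars_iff_distr_eq_PiM')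
  have "distr P (\<Pi>\<^sub>M i\<in>UNIV. Y) (\<lambda>\<omega>. \<lambda>i\<in>UNIV. driving i \<omega>) = distr P S snd"
    by (intro distr_cong sets_PiM_cong refl) (auto simp: driving_def sets_\<nu>)
  then show "distr P (\<Pi>\<^sub>M i\<in>UNIV. Y) (\<lambda>\<omega>. \<lambda>i\<in>UNIV. driving i \<omega>) =
      (\<Pi>\<^sub>M i\<in>UNIV. distr P Y (driving i))"
    by (simp add: distr_driving distr_driving_sequence)
qed auto

lemma distr_initial: "distr P X fst = lam"
proof -
  have "distr P X fst = distr P lam fst"
    by (intro distr_cong) (auto simp: sets_lam)
  then show ?thesis
    by (simp add: S.distr_pair_fst)
qed

section \<open>Invariance under resampling\<close>

text \<open>The first coordinate is untouched, so on rectangles \<open>A \<times> B\<close> the claim reduces to the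
  corresponding invariance of the infinite product of copies of \<open>\<nu>\<close>.\<close>

lemma distr_resample: "distr (P \<Otimes>\<^sub>M \<nu>) P (\<lambda>(\<omega>, y). resample n \<omega> y) = P"
proof (rule pair_measure_eqI[symmetric])
  fix A B assume A [measurable]: "A \<in> sets lam" and B [measurable]: "B \<in> sets S"
  have upd [measurable]: "(\<lambda>(y, s). s(n := y)) \<in> \<nu> \<Otimes>\<^sub>M S \<rightarrow>\<^sub>M S"
    unfolding case_prod_beta
    by (rule measurable_PiM_single') (auto simp: space_pair_measure space_PiM PiE_iff fun_upd_def)
  interpret \<nu>_S: pair_prob_space \<nu> S ..
  \<comment> \<open>\<open>distr_pair_PiM_eq_PiM\<close> puts the new coordinate first, so the order of the
      factors is exchanged here.\<close>
  have "(\<integral>\<^sup>+s. \<integral>\<^sup>+y. indicator B (s(n := y)) \<partial>\<nu> \<partial>S)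
      = (\<integral>\<^sup>+z. indicator B (case z of (y, s) \<Rightarrow> s(n := y)) \<partial>(\<nu> \<Otimes>\<^sub>M S))"
    by (subst \<nu>_S.nn_integral_snd[symmetric]) auto
  also have "\<dots> = emeasure (distr (\<nu> \<Otimes>\<^sub>M S) S (\<lambda>(y, s). s(n := y))) B"
    by (subst nn_integral_distr[symmetric, OF upd]) auto
  also have "distr (\<nu> \<Otimes>\<^sub>M S) S (\<lambda>(y, s). s(n := y)) = S"
    using distr_pair_PiM_eq_PiM[of UNIV "\<lambda>_. \<nu>" n] \<nu>.prob_space_axioms by simp
  finally have B_inv: "(\<integral>\<^sup>+s. \<integral>\<^sup>+y. indicator B (s(n := y)) \<partial>\<nu> \<partial>S) = emeasure S B" .
  have [measurable]: "(\<lambda>(s, y). s(n := y)) \<in> S \<Otimes>\<^sub>M \<nu> \<rightarrow>\<^sub>M S"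
    unfolding case_prod_beta
    by (rule measurable_PiM_single') (auto simp: space_pair_measure space_PiM PiE_iff fun_upd_def)
  have "emeasure (distr (P \<Otimes>\<^sub>M \<nu>) P (\<lambda>(\<omega>, y). resample n \<omega> y)) (A \<times> B)
      = (\<integral>\<^sup>+z. indicator (A \<times> B) (case z of (\<omega>, y) \<Rightarrow> resample n \<omega> y) \<partial>(P \<Otimes>\<^sub>M \<nu>))"
    by (subst nn_integral_distr[symmetric, OF measurable_resample]) auto
  also have "\<dots> = (\<integral>\<^sup>+\<omega>. \<integral>\<^sup>+y. indicator (A \<times> B) (resample n \<omega> y) \<partial>\<nu> \<partial>P)"
    by (subst \<nu>.nn_integral_fst[symmetric]) auto
  also have "\<dots> = (\<integral>\<^sup>+\<omega>. indicator A (fst \<omega>) * (\<integral>\<^sup>+y. indicator B ((snd \<omega>)(n := y)) \<partial>\<nu>) \<partial>P)"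
    by (intro nn_integral_cong, subst nn_integral_cmult[symmetric])
       (auto simp: resample_def indicator_times space_pair_measure)
  also have "\<dots> = (\<integral>\<^sup>+x. \<integral>\<^sup>+s. indicator A x * (\<integral>\<^sup>+y. indicator B (s(n := y)) \<partial>\<nu>) \<partial>S \<partial>lam)"
    by (subst S.nn_integral_fst[symmetric]) auto
  also have "\<dots> = (\<integral>\<^sup>+x. indicator A x * emeasure S B \<partial>lam)"
    by (intro nn_integral_cong, subst nn_integral_cmult) (auto simp: B_inv)
  also have "\<dots> = emeasure lam A * emeasure S B"
    by (subst nn_integral_multc) auto
  finally show "emeasure lam A * emeasure S B
      = emeasure (distr (P \<Otimes>\<^sub>M \<nu>) P (\<lambda>(\<omega>, y). resample n \<omega> y)) (A \<times> B)"
    by simp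
qed (auto intro: lam.sigma_finite_measure_axioms S.sigma_finite_measure_axioms)

text \<open>The Markov property in weighted form. The weight is constant in the resampled value, so it can be
  taken out of the inner integral at every sample point: where \<open>y \<mapsto> f (F (T n, y))\<close> is not
  integrable, its integral has the default value 0, and the product is either not integrable in
  \<open>y\<close> as well or identically 0.\<close>

lemma one_step:
  fixes g :: "'a \<times> (nat \<Rightarrow> 'b) \<Rightarrow> real"
  assumes [measurable]: "f \<in> borel_measurable X"
    and g: "\<And>\<omega> y. \<omega> \<in> space P \<Longrightarrow> y \<in> space Y \<Longrightarrow> g (resample n \<omega> y) = g \<omega>"
    and int: "integrable P (\<lambda>\<omega>. g \<omega> * f (orbit F (Suc n) \<omega>))"
  shows "integrable P (\<lambda>\<omega>. g \<omega> * R f (orbit F n \<omega>))"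
    and "(\<integral>\<omega>. g \<omega> * f (orbit F (Suc n) \<omega>) \<partial>P) = (\<integral>\<omega>. g \<omega> * R f (orbit F n \<omega>) \<partial>P)"
proof -
  let ?k = "\<lambda>\<omega>. g \<omega> * f (orbit F (Suc n) \<omega>)" and ?W = "\<lambda>(\<omega>, y). resample n \<omega> y"
  let ?l = "\<lambda>(\<omega>, y). g \<omega> * f (F (orbit F n \<omega>, y))"
  have k [measurable]: "?k \<in> borel_measurable P"
    using int by (rule borel_measurable_integrable)
  have eq: "?k (?W z) = ?l z" if "z \<in> space (P \<Otimes>\<^sub>M \<nu>)" for z
    using that by (auto simp: space_pair_measure[of P] space_\<nu> g orbit_Suc_resample simp del: orbit.simps)
  have "integrable (distr (P \<Otimes>\<^sub>M \<nu>) P ?W) ?k"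
    using int by (simp only: distr_resample)
  then have "integrable (P \<Otimes>\<^sub>M \<nu>) (\<lambda>z. ?k (?W z))"
    by (simp only: integrable_distr_eq[OF measurable_resample k])
  then have l: "integrable (P \<Otimes>\<^sub>M \<nu>) ?l"
    by (subst (asm) Bochner_Integration.integrable_cong[OF refl eq])
  have inner: "(\<integral>y. ?l (\<omega>, y) \<partial>\<nu>) = g \<omega> * R f (orbit F n \<omega>)" for \<omega>
    by (simp add: transfer_op_def)
  show "integrable P (\<lambda>\<omega>. g \<omega> * R f (orbit F n \<omega>))"
    using P_\<nu>.integrable_fst'[OF l] by (simp only: inner)
  have "integral\<^sup>L P ?k = integral\<^sup>L (distr (P \<Otimes>\<^sub>M \<nu>) P ?W) ?k"
    by (simp only: distr_resample)
  also have "\<dots> = (\<integral>z. ?k (?W z) \<partial>(P \<Otimes>\<^sub>M \<nu>))"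
    by (rule integral_distr[OF measurable_resample k])
  also have "\<dots> = integral\<^sup>L (P \<Otimes>\<^sub>M \<nu>) ?l"
    by (intro Bochner_Integration.integral_cong refl eq)
  also have "\<dots> = (\<integral>\<omega>. g \<omega> * R f (orbit F n \<omega>) \<partial>P)"
    using P_\<nu>.integral_fst'[OF l] by (simp only: inner)
  finally show "integral\<^sup>L P ?k = (\<integral>\<omega>. g \<omega> * R f (orbit F n \<omega>) \<partial>P)" .
qed

section \<open>The Markov property\<close>

lemma sets_past_algebra:
  "sets (past_algebra (space P) X (orbit F) n)
    = sigma_sets (space P) (\<Union>i\<le>n. {orbit F i -` A \<inter> space P | A. A \<in> sets X})"
  unfolding past_algebra_def by (rule sets_measure_of) auto

lemma space_past_algebra: "space (past_algebra (space P) X (orbit F) n) = space P"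
  unfolding past_algebra_def by (rule space_measure_of) auto

lemma subalgebra_past: "subalgebra P (past_algebra (space P) X (orbit F) n)"
  unfolding subalgebra_def sets_past_algebra space_past_algebra
  by (auto intro!: sets.sigma_sets_subset)

lemma state_algebra_subset_past:
  "sets (vimage_algebra (space P) (orbit F n) X) \<subseteq> sets (past_algebra (space P) X (orbit F) n)"
  unfolding sets_past_algebra sets_vimage_algebra by (intro sigma_sets_mono') auto

text \<open>The events that do not depend on the \<open>n\<close>-th driving value are closed under complements and
  countable unions, and by \<open>orbit_resample\<close> they include the generators of the past.\<close>

lemma past_event_resample:
  assumes "A \<in> sets (past_algebra (space P) X (orbit F) n)" and "\<omega> \<in> space P" and "y \<in> space Y"
  shows "resample n \<omega> y \<in> A \<longleftrightarrow> \<omega> \<in> A"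
  using assms(1) unfolding sets_past_algebra
proof (induction rule: sigma_sets.induct)
  case (Basic A)
  then show ?case
    using assms(2,3) by (auto simp: orbit_resample resample_in_space)
next
  case (Compl A)
  then show ?case
    using assms(2,3) by (auto simp: resample_in_space)
qed auto

text \<open>The lower bound on \<open>G\<close> makes the candidate \<open>(R f) (T n)\<close> measurable, the upper bound makes the
  indicators of its events admissible weights in \<open>one_step\<close>. Both sigma-algebras of the Markov
  property are extreme cases.\<close>

lemma cond_exp_next_state:
  assumes f [measurable]: "f \<in> borel_measurable X"
    and int: "integrable P (\<lambda>\<omega>. f (orbit F (Suc n) \<omega>))"
    and G: "space G = space P"
    and lower: "sets (vimage_algebra (space P) (orbit F n) X) \<subseteq> sets G"
    and upper: "sets G \<subseteq> sets (past_algebra (space P) X (orbit F) n)"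
  shows "AE \<omega> in P. real_cond_exp P G (\<lambda>\<omega>. f (orbit F (Suc n) \<omega>)) \<omega> = R f (orbit F n \<omega>)"
proof -
  have "subalgebra P G"
    using G upper subalgebra_past[of n] unfolding subalgebra_def by blast
  then interpret finite_measure_subalgebra P G
    by unfold_locales
  have "orbit F n \<in> vimage_algebra (space P) (orbit F n) X \<rightarrow>\<^sub>M X"
    by (intro measurable_vimage_algebra1 funcsetI measurable_space[OF measurable_orbit])
  then have "orbit F n \<in> G \<rightarrow>\<^sub>M X"
    using lower G by (auto simp: measurable_def)
  then have meas: "(\<lambda>\<omega>. R f (orbit F n \<omega>)) \<in> borel_measurable G"
    by simp
  show ?thesis
  proof (rule real_cond_exp_charact[OF _ int _ meas])
    show "integrable P (\<lambda>\<omega>. R f (orbit F n \<omega>))"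
      using one_step(1)[OF f, of "\<lambda>_. 1" n] int by simp
  next
    fix A assume "A \<in> sets G"
    then have A: "A \<in> sets (past_algebra (space P) X (orbit F) n)"
      using upper by blast
    then have [measurable]: "A \<in> sets P"
      using subalgebra_past by (auto simp: subalgebra_def)
    have "integrable P (\<lambda>\<omega>. indicator A \<omega> * f (orbit F (Suc n) \<omega>))"
      using integrable_mult_indicator[OF \<open>A \<in> sets P\<close> int] by simp
    then show "(\<integral>\<omega>\<in>A. f (orbit F (Suc n) \<omega>) \<partial>P) = (\<integral>\<omega>\<in>A. R f (orbit F n \<omega>) \<partial>P)"
      unfolding set_lebesgue_integral_def real_scaleR_def
      by (intro one_step(2)[OF f]) (auto simp: indicator_def past_event_resample[OF A])
  qed
qed

section \<open>The path formula\<close>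

lemma integral_path_product:
  assumes "\<And>i. i \<le> n \<Longrightarrow> f i \<in> borel_measurable X" and "h \<in> borel_measurable X"
    and "integrable P (\<lambda>\<omega>. (\<Prod>i\<le>n. f i (orbit F i \<omega>)) * h (orbit F n \<omega>))"
  shows "(\<integral>\<omega>. (\<Prod>i\<le>n. f i (orbit F i \<omega>)) * h (orbit F n \<omega>) \<partial>P)
    = (\<integral>x. nested_transfer R h f n 0 x \<partial>lam)"
  using assms
proof (induction n arbitrary: h)
  case 0
  then have [measurable]: "f 0 \<in> borel_measurable X" "h \<in> borel_measurable X"
    by auto
  have "(\<integral>\<omega>. f 0 (fst \<omega>) * h (fst \<omega>) \<partial>P) = (\<integral>x. f 0 x * h x \<partial>distr P X fst)"
    by (subst integral_distr) auto
  then show ?case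
    by (simp add: distr_initial)
next
  case (Suc n)
  let ?g = "\<lambda>\<omega>. \<Prod>i\<le>n. f i (orbit F i \<omega>)" and ?q = "\<lambda>x. f (Suc n) x * h x"
  have q: "?q \<in> borel_measurable X"
    using Suc.prems(1)[of "Suc n"] Suc.prems(2) by simp
  have g: "?g (resample n \<omega> y) = ?g \<omega>" for \<omega> y
    by (intro prod.cong) (auto simp: orbit_resample)
  have split: "(\<Prod>i\<le>Suc n. f i (orbit F i \<omega>)) * h (orbit F (Suc n) \<omega>) = ?g \<omega> * ?q (orbit F (Suc n) \<omega>)"
    for \<omega> by (simp add: mult.assoc)
  note step = one_step[OF q g Suc.prems(3)[unfolded split]]
  have "(\<integral>\<omega>. (\<Prod>i\<le>Suc n. f i (orbit F i \<omega>)) * h (orbit F (Suc n) \<omega>) \<partial>P)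
      = (\<integral>\<omega>. ?g \<omega> * R ?q (orbit F n \<omega>) \<partial>P)"
    unfolding split by (rule step(2))
  also have "\<dots> = (\<integral>x. nested_transfer R (R ?q) f n 0 x \<partial>lam)"
    using Suc.prems(1) q step(1) by (intro Suc.IH) auto
  also have "\<dots> = (\<integral>x. nested_transfer R h f (Suc n) 0 x \<partial>lam)"
    by (subst nested_transfer_Suc_weight) simp
  finally show ?case .
qed

end

section \<open>Existence of the driven process\<close>

theorem theorem2p30:
  fixes X lam :: "'a measure" and Y \<nu> :: "'b measure" and F :: "'a \<times> 'b \<Rightarrow> 'a"
  assumes F: "F \<in> X \<Otimes>\<^sub>M Y \<rightarrow>\<^sub>M X"
    and lam: "prob_space lam" "sets lam = sets X"
    and \<nu>: "prob_space \<nu>" "sets \<nu> = sets Y"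
  shows "\<exists>(P :: ('a \<times> (nat \<Rightarrow> 'b)) measure) (T :: nat \<Rightarrow> 'a \<times> (nat \<Rightarrow> 'b) \<Rightarrow> 'a).
    prob_space P \<and> sets P = sets (sample_space X Y)
    \<and> prob_space.indep_vars P (\<lambda>_. Y) driving UNIV \<and> (\<forall>n. distr P Y (driving n) = \<nu>)
    \<and> (\<forall>n. T n \<in> P \<rightarrow>\<^sub>M X)
    \<and> distr P X (T 0) = lam
    \<and> (\<forall>f \<in> borel_measurable X. \<forall>y \<in> space Y.
          (\<integral>\<omega>. f (F (T 0 \<omega>, y)) \<partial>P) = (\<integral>x. (f (F (x, y)) :: real) \<partial>lam))
    \<and> (\<forall>n. \<forall>\<omega> \<in> space P. T (Suc n) \<omega> = F (T n \<omega>, driving n \<omega>))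
    \<and> (\<forall>n. \<forall>f \<in> borel_measurable X. integrable P (\<lambda>\<omega>. f (T (Suc n) \<omega>)) \<longrightarrow>
          (AE \<omega> in P.
            real_cond_exp P (vimage_algebra (space P) (T n) X) (\<lambda>\<omega>. f (T (Suc n) \<omega>)) \<omega>
              = real_cond_exp P (past_algebra (space P) X T n) (\<lambda>\<omega>. f (T (Suc n) \<omega>)) \<omega>
            \<and> real_cond_exp P (past_algebra (space P) X T n) (\<lambda>\<omega>. f (T (Suc n) \<omega>)) \<omega>
              = transfer_op \<nu> F f (T n \<omega>)))
    \<and> (\<forall>n. \<forall>f :: nat \<Rightarrow> 'a \<Rightarrow> real.
          (\<forall>i\<le>n. f i \<in> borel_measurable X) \<and> integrable P (\<lambda>\<omega>. \<Prod>i\<le>n. f i (T i \<omega>)) \<longrightarrow>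
          (\<integral>\<omega>. (\<Prod>i\<le>n. f i (T i \<omega>)) \<partial>P)
            = (\<integral>x. nested_transfer (transfer_op \<nu> F) (\<lambda>_. 1) f n 0 x \<partial>lam))"
proof -
  interpret random_iteration X lam Y \<nu> F
    using F lam \<nu> by (intro random_iteration.intro random_iteration_axioms.intro)
  show ?thesis
  proof (intro exI[of _ P] exI[of _ "orbit F"] conjI allI ballI impI)
    show "prob_space P"
      by (rule lam_S.prob_space_axioms)
    show "sets P = sets (sample_space X Y)"
      by (rule sets_P)
    show "lam_S.indep_vars (\<lambda>_. Y) driving UNIV"
      by (rule indep_vars_driving)
    show "distr P Y (driving n) = \<nu>" for n
      by (rule distr_driving)
    show "orbit F n \<in> P \<rightarrow>\<^sub>M X" for n
      by (rule measurable_orbit)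
    have T0: "orbit F 0 = fst"
      by (rule ext) simp
    show T0_law: "distr P X (orbit F 0) = lam"
      unfolding T0 by (rule distr_initial)
    show "orbit F (Suc n) \<omega> = F (orbit F n \<omega>, driving n \<omega>)" for n \<omega>
      by simp
    show "(\<integral>\<omega>. f (F (orbit F 0 \<omega>, y)) \<partial>P) = (\<integral>x. f (F (x, y)) \<partial>lam)"
      if [measurable]: "f \<in> borel_measurable X" "y \<in> space Y" for f :: "'a \<Rightarrow> real" and y
      by (subst T0_law[symmetric], subst integral_distr) auto
    show "AE \<omega> in P.
        real_cond_exp P (vimage_algebra (space P) (orbit F n) X) (\<lambda>\<omega>. f (orbit F (Suc n) \<omega>)) \<omega>
          = real_cond_exp P (past_algebra (space P) X (orbit F) n) (\<lambda>\<omega>. f (orbit F (Suc n) \<omega>)) \<omega>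
        \<and> real_cond_exp P (past_algebra (space P) X (orbit F) n) (\<lambda>\<omega>. f (orbit F (Suc n) \<omega>)) \<omega>
          = transfer_op \<nu> F f (orbit F n \<omega>)"
      if "f \<in> borel_measurable X" "integrable P (\<lambda>\<omega>. f (orbit F (Suc n) \<omega>))" for n f
      using cond_exp_next_state[OF that _ order_refl state_algebra_subset_past]
        cond_exp_next_state[OF that space_past_algebra state_algebra_subset_past order_refl]
      by (auto simp del: orbit.simps)
    show "(\<integral>\<omega>. (\<Prod>i\<le>n. f i (orbit F i \<omega>)) \<partial>P)
        = (\<integral>x. nested_transfer (transfer_op \<nu> F) (\<lambda>_. 1) f n 0 x \<partial>lam)"
      if "(\<forall>i\<le>n. f i \<in> borel_measurable X) \<and> integrable P (\<lambda>\<omega>. \<Prod>i\<le>n. f i (orbit F i \<omega>))"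
      for n and f :: "nat \<Rightarrow> 'a \<Rightarrow> real"
      using integral_path_product[of n f "\<lambda>_. 1"] that by simp
  qed
qed

end
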